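(* Let $\eta$ be a compactly supported Borel probability measure on $\mathbb R^2$ with first and second marginals $\mu$ and $\nu$, let $(\eta_t)_{t\ge1}$ be its partial bi-free convolution semigroup, and let $t>1$ be given. Assume that there is a point $(\xi,\zeta)\in\mathbb R^2$ such that $\eta_t(\{(\xi,\zeta)\})>0$. Then $\eta(\{(\xi/t,\zeta/t)\})>0$ and $$\eta_t(\{(\xi,\zeta)\})=\frac{\big(t\mu(\{\xi/t\})+1-t\big)\big(t\nu(\{\zeta/t\})+1-t\big)\,\eta(\{(\xi/t,\zeta/t)\})}{t\,\mu(\{\xi/t\})\,\nu(\{\zeta/t\})+(1-t)\,\eta(\{(\xi/t,\zeta/t)\})}.$$
   Context: For a compactly supported probability measure $\eta$ on $\mathbb R^2$ with marginals $\mu,\nu$, put $G_\eta(z,w)=\int\frac{d\eta(t,s)}{(z-t)(w-s)}$, $G_\mu(z)=\int\frac{d\mu(t)}{z-t}$, let $K_\mu$ be the compositional inverse of $G_\mu$ near infinity and $R_\mu(z)=K_\mu(z)-1/z$ (similarly for $\nu$). The partial bi-free $R$-transform of $\eta$ is, for $z,w$ near $0$, $$R_\eta(z,w)=1+zR_\mu(z)+wR_\nu(w)-\frac{zw}{G_\eta(K_\mu(z),K_\nu(w))}.$$ It determines $\eta$ and linearizes the bi-free additive convolution: $R_{\eta_1\boxplus\boxplus\eta_2}=R_{\eta_1}+R_{\eta_2}$. It is known that for every compactly supported $\eta$ there is a unique family $(\eta_t)_{t\ge1}$ of compactly supported probability measures on $\mathbb R^2$ with $R_{\eta_t}=tR_\eta$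 near $(0,0)$ for all $t\geq 1$; it satisfies $\eta_1=\eta$, $\eta_{s+t}=\eta_s\boxplus\boxplus\eta_t$ for $s,t\ge1$, and is called the partial bi-free convolution semigroup of $\eta$. *)

theory Defs
  imports "HOL-Probability.Probability"
begin

definition compactly_supported_prob :: "'a::topological_space measure \<Rightarrow> bool" where
  "compactly_supported_prob M \<longleftrightarrow>
     prob_space M \<and> sets M = sets borel \<and> (\<exists>S. compact S \<and> (AE x in M. x \<in> S))"

definition cauchy_transform :: "real measure \<Rightarrow> complex \<Rightarrow> complex" where
  "cauchy_transform \<mu> z = (\<integral>t. 1 / (z - of_real t) \<partial>\<mu>)"

definition cauchy_transform2 :: "(real \<times> real) measure \<Rightarrow> complex \<Rightarrow> complex \<Rightarrow> complex" where
  "cauchy_transform2 \<eta> z w = (\<integral>(t, s). 1 / ((z - of_real t) * (w - of_real s)) \<partial>\<eta>)"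

definition is_inverse_near_infinity :: "(complex \<Rightarrow> complex) \<Rightarrow> (complex \<Rightarrow> complex) \<Rightarrow> bool" where
  "is_inverse_near_infinity G K \<longleftrightarrow>
     filterlim K at_infinity (at 0) \<and>
     (\<forall>\<^sub>F z in at 0. G (K z) = z) \<and>
     (\<forall>\<^sub>F z in at_infinity. K (G z) = z)"

(* For compactly supported \<mu> the Cauchy transform is injective near infinity, so the inverse
   exists and any two choices agree on a punctured neighbourhood of 0; only that germ matters. *)
definition K_transform :: "real measure \<Rightarrow> complex \<Rightarrow> complex" where
  "K_transform \<mu> = (SOME K. is_inverse_near_infinity (cauchy_transform \<mu>) K)"

(* The singularity at 0 is removable, and the value there is the limit. *)
definition R_transform :: "real measure \<Rightarrow> complex \<Rightarrow> complex" where
  "R_transform \<mu> z =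
     (if z = 0 then Lim (at 0) (\<lambda>u. K_transform \<mu> u - 1 / u) else K_transform \<mu> z - 1 / z)"

definition marginal1 :: "(real \<times> real) measure \<Rightarrow> real measure" where
  "marginal1 \<eta> = distr \<eta> borel fst"

definition marginal2 :: "(real \<times> real) measure \<Rightarrow> real measure" where
  "marginal2 \<eta> = distr \<eta> borel snd"

(* Meaningful for z \<noteq> 0 and w \<noteq> 0 only, as the K-transforms have a pole at 0. *)
definition bifree_R_formula :: "(real \<times> real) measure \<Rightarrow> complex \<times> complex \<Rightarrow> complex" where
  "bifree_R_formula \<eta> = (\<lambda>(z, w).
     1 + z * R_transform (marginal1 \<eta>) z + w * R_transform (marginal2 \<eta>) w
       - z * w / cauchy_transform2 \<eta> (K_transform (marginal1 \<eta>) z) (K_transform (marginal2 \<eta>) w))"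

(* The formula extends holomorphically to a neighbourhood of (0,0); on the axes z = 0 and w = 0
   the value is that of the extension, i.e. the limit from off the axes. *)
definition bifree_R_transform :: "(real \<times> real) measure \<Rightarrow> complex \<Rightarrow> complex \<Rightarrow> complex" where
  "bifree_R_transform \<eta> z w =
     (if z = 0 \<or> w = 0
      then Lim (at (z, w) within {(u, v). u \<noteq> 0 \<and> v \<noteq> 0}) (bifree_R_formula \<eta>)
      else bifree_R_formula \<eta> (z, w))"

(* The family is only constrained at indices t \<ge> 1; there these conditions determine it. *)
definition bifree_convolution_semigroup ::
    "(real \<times> real) measure \<Rightarrow> (real \<Rightarrow> (real \<times> real) measure) \<Rightarrow> bool" where
  "bifree_convolution_semigroup \<eta> \<eta>t \<longleftrightarrow>
     (\<forall>t\<ge>1. compactly_supported_prob (\<eta>t t) \<and>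
        (\<forall>\<^sub>F (z, w) in nhds (0, 0).
           bifree_R_transform (\<eta>t t) z w = of_real t * bifree_R_transform \<eta> z w))"

end

theory Submission
  imports Defs "HOL-Complex_Analysis.Complex_Analysis"
begin

text \<open>
  Write \<open>G\<close>, \<open>G'\<close> for the Cauchy transforms of a marginal of \<open>\<eta>\<close> and of the corresponding marginal of
  \<open>\<eta>\<^sub>t\<close>. Restricting \<open>R\<^sub>\<eta>\<^sub>t = t R\<^sub>\<eta>\<close> to the axes gives \<open>K'(z) - 1/z = t (K(z) - 1/z)\<close> near \<open>0\<close>, hence
  \<open>G' = G \<circ> \<omega>\<close> near infinity with the explicit subordination function \<open>\<omega>(z) = (z + (t - 1) / G'(z)) / t\<close>.
  As \<open>Im G' < 0\<close> on the upper half-plane, \<open>\<omega>\<close> maps the upper half-plane to itself and the identity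
  persists there. In the same way, off the axes, with \<open>h = G\<^sub>\<eta>(\<omega>\<^sub>1(z), \<omega>\<^sub>2(w))\<close>, \<open>g = G\<^sub>\<eta>\<^sub>t(z, w)\<close> and
  \<open>A = G'\<^sub>1(z) G'\<^sub>2(w)\<close>, one gets \<open>h A = g (t A - (t - 1) h)\<close> for all \<open>z\<close>, \<open>w\<close> in the upper half-plane.
  Let \<open>z \<rightarrow> \<xi>\<close> and \<open>w \<rightarrow> \<zeta>\<close> vertically. Then \<open>(z - \<xi>) G'\<^sub>1(z)\<close> tends to an atom, which is positive by
  assumption, so \<open>(\<omega>\<^sub>1(z) - \<xi>/t) / (z - \<xi>)\<close> has a positive real limit, \<open>\<omega>\<^sub>1(z) \<rightarrow> \<xi>/t\<close>
  nontangentially, and all transforms rescaled by the distances to \<open>\<xi>\<close>, \<open>\<zeta>\<close>, \<open>\<xi>/t\<close>, \<open>\<zeta>/t\<close> converge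
  to atoms; the limit of the identity is the claim.
\<close>

section \<open>Cauchy transforms of bounded random variables\<close>

definition wcauchy :: "'a measure \<Rightarrow> ('a \<Rightarrow> complex) \<Rightarrow> ('a \<Rightarrow> real) \<Rightarrow> complex \<Rightarrow> complex" where
  "wcauchy M \<phi> a z = (\<integral>x. \<phi> x / (z - of_real (a x)) \<partial>M)"

definition bcauchy :: "'a measure \<Rightarrow> ('a \<Rightarrow> real) \<Rightarrow> ('a \<Rightarrow> real) \<Rightarrow> complex \<Rightarrow> complex \<Rightarrow> complex" where
  "bcauchy M a b z w = (\<integral>x. 1 / ((z - of_real (a x)) * (w - of_real (b x))) \<partial>M)"

lemma bcauchy_eq_wcauchy_fst:
  "bcauchy M a b z w = wcauchy M (\<lambda>x. 1 / (w - of_real (b x))) a z"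
  unfolding bcauchy_def wcauchy_def by (simp add: mult.commute)

lemma bcauchy_eq_wcauchy_snd:
  "bcauchy M a b z w = wcauchy M (\<lambda>x. 1 / (z - of_real (a x))) b w"
  unfolding bcauchy_def wcauchy_def by simp

lemma bcauchy_commute: "bcauchy M a b z w = bcauchy M b a w z"
  unfolding bcauchy_def by (simp add: mult.commute)

lemma norm_minus_of_real_ge:
  fixes z :: complex
  assumes "\<bar>s\<bar> \<le> R"
  shows "norm z - R \<le> norm (z - of_real s)"
  using norm_triangle_ineq2[of z "of_real s"] assms by simp

section \<open>Holomorphy of weighted Cauchy transforms and their behaviour at infinity\<close>

lemma (in prob_space) norm_integral_le_AE:
  fixes f :: "'a \<Rightarrow> complex"
  assumes "AE x in M. norm (f x) \<le> C" "0 \<le> C"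
  shows "norm (integral\<^sup>L M f) \<le> C"
proof (cases "integrable M f")
  case True
  have "norm (integral\<^sup>L M f) \<le> (\<integral>x. norm (f x) \<partial>M)"
    by simp
  also have "\<dots> \<le> (\<integral>x. C \<partial>M)"
    using True assms by (intro integral_mono_AE) auto
  finally show ?thesis
    by (simp add: prob_space)
next
  case False
  then show ?thesis
    using assms by (simp add: not_integrable_integral_eq)
qed

text \<open>Differentiation under the integral sign by an explicit estimate: with
  \<open>p = z - a x\<close> and \<open>q = z0 - a x\<close>, the error of the difference quotient
  is the integral of \<open>\<phi> x (p - q) / (p q^2)\<close>, which is of order
  \<open>norm (z - z0)\<close>. Phrasing the hypothesis as a distance \<open>\<delta>\<close> covers
  both the upper half-plane and the exterior of a disc.\<close>

lemma (in prob_space) wcauchy_has_derivative: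
  fixes a :: "'a \<Rightarrow> real"
  assumes [measurable]: "\<phi> \<in> borel_measurable M" "a \<in> borel_measurable M"
    and \<phi>: "AE x in M. norm (\<phi> x) \<le> B"
    and \<delta>: "0 < \<delta>" "AE x in M. \<delta> \<le> norm (z0 - of_real (a x))"
  shows "(wcauchy M \<phi> a has_field_derivative - (\<integral>x. \<phi> x / (z0 - of_real (a x))\<^sup>2 \<partial>M)) (at z0)"
proof -
  define L where "L = (\<integral>x. \<phi> x / (z0 - of_real (a x))\<^sup>2 \<partial>M)"
  have B: "0 \<le> B"
  proof -
    have "AE x in M. 0 \<le> B"
      using \<phi> by eventually_elim (meson norm_ge_zero order_trans)
    then show ?thesis by simp
  qed
  \<comment> \<open>Within radius \<open>\<delta> / 2\<close> of \<open>z0\<close> the denominators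
    \<open>z - a x\<close> keep modulus at least \<open>\<delta> / 2\<close>; this produces the
    constant \<open>2 * B / \<delta> ^ 3\<close>.\<close>
  have bound: "norm ((wcauchy M \<phi> a z - wcauchy M \<phi> a z0) / (z - z0) + L) \<le> 2 * B / \<delta> ^ 3 * norm (z - z0)"
    if z: "z \<noteq> z0" "norm (z - z0) < \<delta> / 2" for z
  proof -
    have z\<delta>: "AE x in M. \<delta> / 2 \<le> norm (z - of_real (a x))"
      using \<delta>(2)
    proof eventually_elim
      case (elim x)
      have "norm (z0 - of_real (a x)) \<le> norm (z - of_real (a x)) + norm (z - z0)"
        using norm_triangle_ineq4[of "z - of_real (a x)" "z - z0"] by simp
      then show ?case using elim z(2) by linarith
    qed
    have i1: "integrable M (\<lambda>x. \<phi> x / (z - of_real (a x)))"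
    proof (rule integrable_const_bound)
      show "AE x in M. norm (\<phi> x / (z - of_real (a x))) \<le> B / (\<delta> / 2)"
        using \<phi> z\<delta>
        by eventually_elim (unfold norm_divide, intro frac_le, use \<delta>(1) B in auto)
    qed simp
    have i2: "integrable M (\<lambda>x. \<phi> x / (z0 - of_real (a x)))"
    proof (rule integrable_const_bound)
      show "AE x in M. norm (\<phi> x / (z0 - of_real (a x))) \<le> B / \<delta>"
        using \<phi> \<delta>(2)
        by eventually_elim (use \<delta>(1) B in \<open>auto simp: norm_divide intro!: frac_le\<close>)
    qed simp
    have i3: "integrable M (\<lambda>x. \<phi> x / (z0 - of_real (a x))\<^sup>2)"
    proof (rule integrable_const_bound)
      show "AE x in M. norm (\<phi> x / (z0 - of_real (a x))\<^sup>2) \<le> B / \<delta>\<^sup>2"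
        using \<phi> \<delta>(2)
        by eventually_elim
          (use \<delta>(1) B in \<open>auto simp: norm_divide norm_power intro!: frac_le power_mono\<close>)
    qed simp
    have "(wcauchy M \<phi> a z - wcauchy M \<phi> a z0) / (z - z0) + L
       = (\<integral>x. (\<phi> x / (z - of_real (a x)) - \<phi> x / (z0 - of_real (a x))) / (z - z0)
                + \<phi> x / (z0 - of_real (a x))\<^sup>2 \<partial>M)"
      unfolding wcauchy_def L_def using i1 i2 i3 by simp
    also have "norm \<dots> \<le> 2 * B / \<delta> ^ 3 * norm (z - z0)"
    proof (rule norm_integral_le_AE)
      show "AE x in M. norm ((\<phi> x / (z - of_real (a x)) - \<phi> x / (z0 - of_real (a x))) / (z - z0)
                + \<phi> x / (z0 - of_real (a x))\<^sup>2) \<le> 2 * B / \<delta> ^ 3 * norm (z - z0)"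
        using \<phi> \<delta>(2) z\<delta>
      proof eventually_elim
        case (elim x)
        define p q where "p = z - of_real (a x)" and "q = z0 - of_real (a x)"
        have pq: "p \<noteq> 0" "q \<noteq> 0" "z - z0 = p - q" "p - q \<noteq> 0"
          using elim \<delta>(1) z unfolding p_def q_def by auto
        have "(\<phi> x / p - \<phi> x / q) / (p - q) + \<phi> x / q\<^sup>2 = \<phi> x * (p - q) / (p * q\<^sup>2)"
          using pq(1,2,4) by (simp add: divide_simps power2_eq_square) algebra
        moreover have "norm (\<phi> x * (p - q) / (p * q\<^sup>2)) \<le> B * norm (p - q) / (\<delta> / 2 * \<delta>\<^sup>2)"
          unfolding norm_divide norm_mult norm_power
          using elim \<delta>(1) B unfolding p_def q_def
          by (intro frac_le mult_mono power_mono) auto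
        moreover have "\<dots> = 2 * B / \<delta> ^ 3 * norm (p - q)"
          using \<delta>(1) by (simp add: divide_simps power2_eq_square power3_eq_cube)
        ultimately show ?case
          unfolding p_def[symmetric] q_def[symmetric] pq(3) by simp
      qed
    qed (use B \<delta> in auto)
    finally show ?thesis .
  qed
  have "((\<lambda>z. (wcauchy M \<phi> a z - wcauchy M \<phi> a z0) / (z - z0) + L) \<longlongrightarrow> 0) (at z0)"
  proof (rule Lim_null_comparison)
    show "\<forall>\<^sub>F z in at z0. norm ((wcauchy M \<phi> a z - wcauchy M \<phi> a z0) / (z - z0) + L)
            \<le> 2 * B / \<delta> ^ 3 * norm (z - z0)"
      unfolding eventually_at
      by (rule exI[of _ "\<delta> / 2"]) (use \<delta> bound in \<open>auto simp: dist_norm\<close>)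
    show "((\<lambda>z. 2 * B / \<delta> ^ 3 * norm (z - z0)) \<longlongrightarrow> 0) (at z0)"
      by (rule tendsto_eq_intros | simp)+
  qed
  from tendsto_diff[OF this tendsto_const[of L]]
  show ?thesis
    unfolding has_field_derivative_iff L_def by simp
qed

text \<open>Compact support of the law of \<open>a\<close>, expressed as an essential bound. Random
  variables on one space, rather than marginal laws, keep the joint law of two coordinates
  available.\<close>

locale bounded_rv = prob_space M for M :: "'a measure" +
  fixes a :: "'a \<Rightarrow> real"
  assumes measurable_rv [measurable]: "a \<in> borel_measurable M"
    and bounded_AE: "\<exists>R>0. AE x in M. \<bar>a x\<bar> \<le> R"
begin

lemma wcauchy_holomorphic_upper:
  assumes "\<phi> \<in> borel_measurable M" "AE x in M. norm (\<phi> x) \<le> B"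
  shows "wcauchy M \<phi> a holomorphic_on {z. 0 < Im z}"
proof (rule holomorphic_onI)
  fix z :: complex assume z: "z \<in> {z. 0 < Im z}"
  have "AE x in M. Im z \<le> norm (z - of_real (a x))"
    by (rule AE_I2) (use abs_Im_le_cmod[of "z - of_real _"] in \<open>simp add: abs_le_iff\<close>)
  from wcauchy_has_derivative[OF assms(1) measurable_rv assms(2) _ this] z
  show "wcauchy M \<phi> a field_differentiable at z within {z. 0 < Im z}"
    using field_differentiable_at_within field_differentiable_def by blast
qed

lemma wcauchy_holomorphic_outside:
  assumes "\<phi> \<in> borel_measurable M" "AE x in M. norm (\<phi> x) \<le> B"
    and R: "AE x in M. \<bar>a x\<bar> \<le> R"
  shows "wcauchy M \<phi> a holomorphic_on {z. R < norm z}"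
proof (rule holomorphic_onI)
  fix z :: complex assume z: "z \<in> {z. R < norm z}"
  have "AE x in M. norm z - R \<le> norm (z - of_real (a x))"
    using R by eventually_elim (rule norm_minus_of_real_ge)
  from wcauchy_has_derivative[OF assms(1) measurable_rv assms(2) _ this] z
  show "wcauchy M \<phi> a field_differentiable at z within {z. R < norm z}"
    using field_differentiable_at_within field_differentiable_def by (metis diff_gt_0_iff_gt mem_Collect_eq)
qed

text \<open>For \<open>norm z > R\<close> the difference from the limit is the integral of
  \<open>\<phi> x a x / (z - a x)\<close>, at most \<open>B R / (norm z - R)\<close> in modulus. The
  weight \<open>1\<close> gives the normalisation of Cauchy transforms; a kernel as weight gives the
  limit of the two-variable transform in one argument.\<close>

lemma wcauchy_at_infinity:
  assumes [measurable]: "\<phi> \<in> borel_measurable M" and \<phi>: "AE x in M. norm (\<phi> x) \<le> B"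
  shows "((\<lambda>z. z * wcauchy M \<phi> a z) \<longlongrightarrow> (\<integral>x. \<phi> x \<partial>M)) at_infinity"
proof -
  obtain R where R: "0 < R" "AE x in M. \<bar>a x\<bar> \<le> R"
    using bounded_AE by blast
  have B: "0 \<le> B"
  proof -
    have "AE x in M. 0 \<le> B"
      using \<phi> by eventually_elim (meson norm_ge_zero order_trans)
    then show ?thesis by simp
  qed
  have bound: "norm (z * wcauchy M \<phi> a z - (\<integral>x. \<phi> x \<partial>M)) \<le> B * R / (norm z - R)"
    if z: "R < norm z" for z
  proof -
    have z\<delta>: "AE x in M. norm z - R \<le> norm (z - of_real (a x))"
      using R(2) by eventually_elim (rule norm_minus_of_real_ge)
    have i1: "integrable M (\<lambda>x. \<phi> x / (z - of_real (a x)))"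
    proof (rule integrable_const_bound)
      show "AE x in M. norm (\<phi> x / (z - of_real (a x))) \<le> B / (norm z - R)"
        using \<phi> z\<delta>
        by eventually_elim (use z B in \<open>auto simp: norm_divide intro!: frac_le\<close>)
    qed simp
    have i2: "integrable M \<phi>"
      by (rule integrable_const_bound[OF \<phi>]) simp
    have "z * wcauchy M \<phi> a z - (\<integral>x. \<phi> x \<partial>M) = (\<integral>x. z * (\<phi> x / (z - of_real (a x))) - \<phi> x \<partial>M)"
    proof -
      have "integrable M (\<lambda>x. z * (\<phi> x / (z - of_real (a x))))"
        using i1 by (intro integrable_mult_right)
      then show ?thesis
        unfolding wcauchy_def
        by (simp only: Bochner_Integration.integral_diff i2 integral_mult_right_zero)
    qed
    also have "norm \<dots> \<le> B * R / (norm z - R)"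
    proof (rule norm_integral_le_AE)
      show "AE x in M. norm (z * (\<phi> x / (z - of_real (a x))) - \<phi> x) \<le> B * R / (norm z - R)"
        using \<phi> z\<delta> R(2)
      proof eventually_elim
        case (elim x)
        then have "z - of_real (a x) \<noteq> 0"
          using z by auto
        then have "z * (\<phi> x / (z - of_real (a x))) - \<phi> x = \<phi> x * of_real (a x) / (z - of_real (a x))"
          by (simp add: field_simps)
        also have "norm \<dots> \<le> B * R / (norm z - R)"
          unfolding norm_divide norm_mult
          using elim z B R by (intro frac_le mult_mono) auto
        finally show ?case .
      qed
    qed (use B R z in auto)
    finally show ?thesis .
  qed
  have "((\<lambda>z. z * wcauchy M \<phi> a z - (\<integral>x. \<phi> x \<partial>M)) \<longlongrightarrow> 0) at_infinity"
  proof (rule Lim_null_comparison)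
    show "\<forall>\<^sub>F z in at_infinity. norm (z * wcauchy M \<phi> a z - (\<integral>x. \<phi> x \<partial>M)) \<le> B * R / (norm z - R)"
      unfolding eventually_at_infinity
      by (rule exI[of _ "R + 1"]) (use bound in auto)
    have "filterlim (\<lambda>z::complex. - R + norm z) at_top at_infinity"
      by (intro filterlim_tendsto_add_at_top[OF tendsto_const] filterlim_at_infinity_imp_norm_at_top filterlim_ident)
    then show "((\<lambda>z::complex. B * R / (norm z - R)) \<longlongrightarrow> 0) at_infinity"
      by (intro tendsto_divide_0[OF tendsto_const] filterlim_at_top_imp_at_infinity) simp
  qed
  then show ?thesis
    by (simp add: Lim_null[symmetric])
qed

end

section \<open>Inversion near infinity and continuation to the upper half-plane\<close>

lemma inverse_near_infinity_exists:
  fixes G :: "complex \<Rightarrow> complex"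
  assumes R: "0 < R" and hol: "G holomorphic_on {z. R < norm z}"
    and lim: "((\<lambda>z. z * G z) \<longlongrightarrow> 1) at_infinity"
  shows "\<exists>K. is_inverse_near_infinity G K"
proof -
  \<comment> \<open>In the coordinate \<open>u = 1/z\<close> the function extends over
    \<open>u = 0\<close> with value \<open>0\<close> and derivative \<open>1\<close>, the limit of
    \<open>z * G z\<close>. Hence it is locally invertible there, and \<open>K\<close> will be the
    reciprocal of the local inverse \<open>h\<close>.\<close>
  define g where "g u = (if u = 0 then 0 else G (inverse u))" for u
  have g0: "(g has_field_derivative 1) (at 0)"
  proof -
    have "((\<lambda>u. inverse u * G (inverse u)) \<longlongrightarrow> 1) (at 0)"
      using filterlim_compose[OF lim filterlim_inverse_at_infinity] by (simp add: o_def)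
    then have "((\<lambda>u. (g u - g 0) / (u - 0)) \<longlongrightarrow> 1) (at 0)"
      by (rule Lim_transform_eventually)
        (auto simp: eventually_at g_def field_simps intro!: exI[of _ 1])
    then show ?thesis
      by (simp add: has_field_derivative_iff)
  qed
  have holg: "g holomorphic_on ball 0 (1 / R)"
  proof (rule holomorphic_onI)
    fix u :: complex assume u: "u \<in> ball 0 (1 / R)"
    show "g field_differentiable at u within ball 0 (1 / R)"
    proof (cases "u = 0")
      case True
      then show ?thesis
        using g0 field_differentiable_at_within field_differentiable_def by blast
    next
      case False
      have "open {z::complex. R < norm z}"
        by (intro open_Collect_less continuous_intros)
      moreover have "R < norm (inverse u)"
        using u False R by (simp add: norm_inverse) (simp add: field_simps)
      ultimately have "G field_differentiable at (inverse u)"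
        using hol by (intro holomorphic_on_imp_differentiable_at) auto
      moreover have "inverse field_differentiable at u"
        using False by (intro field_differentiable_inverse field_differentiable_ident)
      ultimately have "(G \<circ> inverse) field_differentiable at u"
        by (intro field_differentiable_compose)
      \<comment> \<open>\<open>g\<close> and \<open>G \<circ> inverse\<close> agree on the ball of
        radius \<open>norm u\<close> around \<open>u\<close>, since that ball avoids
        \<open>0\<close>.\<close>
      then have "g field_differentiable at u"
      proof (rule field_differentiable_transform_within[rotated -1])
        show "0 < norm u" using False by simp
      qed (auto simp: g_def dist_norm)
      then show ?thesis
        using field_differentiable_at_within by blast
    qed
  qed
  have dnz: "deriv g 0 \<noteq> 0"
    using DERIV_imp_deriv[OF g0] by simp
  have in_ball: "0 \<in> ball (0::complex) (1 / R)"
    using R by simp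
  obtain r where r: "0 < r" "ball (0::complex) r \<subseteq> ball 0 (1 / R)" "inj_on g (ball 0 r)"
    by (rule has_complex_derivative_locally_injective[OF holg in_ball open_ball dnz])
  have holr: "g holomorphic_on ball 0 r"
    using holg r(2) holomorphic_on_subset by blast
  obtain h where h: "h holomorphic_on g ` ball 0 r" "\<And>u. u \<in> ball 0 r \<Longrightarrow> h (g u) = u"
    using holomorphic_has_inverse[OF holr open_ball r(3)] by metis
  have opn: "open (g ` ball 0 r)"
    by (rule open_mapping_thm3[OF holr open_ball r(3)])
  have in0: "0 \<in> g ` ball 0 r"
    using r(1) by (intro image_eqI[of _ _ 0]) (auto simp: g_def)
  have h0: "h 0 = 0"
    using h(2)[of 0] r(1) by (simp add: g_def)
  have ev: "\<forall>\<^sub>F z in at 0. z \<in> g ` ball 0 r \<and> z \<noteq> 0"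
    using eventually_at_in_open[OF opn in0] by simp
  have gh: "g (h z) = z" if "z \<in> g ` ball 0 r" for z
    using that h(2) by auto
  have g_0: "g 0 = 0"
    by (simp add: g_def)
  \<comment> \<open>\<open>h z = 0\<close> would give \<open>z = g (h z) = g 0 = 0\<close>.\<close>
  have ev2: "\<forall>\<^sub>F z in at 0. h z \<noteq> 0 \<and> g (h z) = z"
    using ev by eventually_elim (metis gh g_0)
  have "isCont h 0"
    using continuous_on_eq_continuous_at[OF opn] holomorphic_on_imp_continuous_on[OF h(1)] in0
    by blast
  then have "filterlim h (at 0) (at 0)"
    unfolding filterlim_at isCont_def h0 using ev2 by (auto elim: eventually_mono)
  then have 1: "filterlim (\<lambda>z. inverse (h z)) at_infinity (at 0)"
    by (rule filterlim_compose[OF filterlim_inverse_at_infinity])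
  have 2: "\<forall>\<^sub>F z in at 0. G (inverse (h z)) = z"
    using ev2 by eventually_elim (auto simp: g_def split: if_splits)
  \<comment> \<open>The bound \<open>1 / r + 1\<close> puts \<open>inverse z\<close> inside the ball
    of radius \<open>r\<close>, where \<open>h\<close> inverts \<open>g\<close>.\<close>
  have 3: "\<forall>\<^sub>F z in at_infinity. inverse (h (G z)) = z"
    unfolding eventually_at_infinity
  proof (rule exI[of _ "1 / r + 1"], intro allI impI)
    fix z :: complex assume z: "1 / r + 1 \<le> norm z"
    moreover have "0 < 1 / r" using r(1) by simp
    ultimately have "0 < norm z" "1 / r < norm z"
      by linarith+
    then have "z \<noteq> 0"
      by simp
    have "h (g (inverse z)) = inverse z"
      using r(1) \<open>z \<noteq> 0\<close> \<open>1 / r < norm z\<close> by (intro h(2)) (simp add: norm_inverse, simp add: field_simps)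
    then show "inverse (h (G z)) = z"
      using \<open>z \<noteq> 0\<close> by (simp add: g_def)
  qed
  show ?thesis
    unfolding is_inverse_near_infinity_def using 1 2 3 by blast
qed

text \<open>The points of the half-plane outside a large disc form a nonempty open subset of a
  connected domain, so agreement there propagates. This carries identities known near infinity to
  points close to the real axis, where atoms are read off.\<close>

lemma upper_half_plane_identity:
  assumes "f holomorphic_on {z. 0 < Im z}" "g holomorphic_on {z. 0 < Im z}"
    and ev: "\<forall>\<^sub>F z in at_infinity. 0 < Im z \<longrightarrow> f z = g z"
    and "0 < Im z"
  shows "f z = g z"
proof -
  obtain b where b: "0 < b" "\<And>z. b \<le> norm z \<Longrightarrow> 0 < Im z \<Longrightarrow> f z = g z"
    using ev unfolding eventually_at_infinity_pos by blast
  define S :: "complex set" where "S = {z. 0 < Im z \<and> b < norm z}"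
  show ?thesis
  proof (rule analytic_continuation_open[of S "{z. 0 < Im z}" f g])
    show "open S" "open {z. 0 < Im z}"
      unfolding S_def by (intro open_Collect_conj open_Collect_less continuous_intros)+
    have "\<i> * of_real (b + 1) \<in> S"
      using b(1) unfolding S_def by (simp add: norm_mult del: of_real_add)
    then show "S \<noteq> {}"
      by blast
    show "connected {z. 0 < Im z}"
      by (intro convex_connected convex_halfspace_Im_gt)
    show "S \<subseteq> {z. 0 < Im z}" "\<And>z. z \<in> S \<Longrightarrow> f z = g z"
      using b(2) by (auto simp: S_def)
  qed (use assms in auto)
qed

section \<open>Atoms as nontangential limits of rescaled Cauchy transforms\<close>

lemma tendsto_atom_kernel:
  fixes u :: "nat \<Rightarrow> complex" and \<alpha> s :: real
  assumes u: "u \<longlonglongrightarrow> of_real \<alpha>" and Im: "\<And>n. 0 < Im (u n)"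
  shows "(\<lambda>n. (u n - of_real \<alpha>) / (u n - of_real s)) \<longlonglongrightarrow> (if s = \<alpha> then 1 else 0)"
proof (cases "s = \<alpha>")
  case True
  have "u n \<noteq> of_real \<alpha>" for n
    using Im[of n] by auto
  then show ?thesis
    using True by simp
next
  case False
  have "(\<lambda>n. (u n - of_real \<alpha>) / (u n - of_real s))
      \<longlonglongrightarrow> (of_real \<alpha> - of_real \<alpha>) / (of_real \<alpha> - of_real s)"
    using False by (intro tendsto_intros u) auto
  then show ?thesis
    using False by simp
qed

text \<open>In a Stolz angle at \<open>\<alpha>\<close> one has
  \<open>norm (u - \<alpha>) \<le> C * Im u \<le> C * norm (u - s)\<close> for every real
  \<open>s\<close>. The bound is uniform in \<open>s\<close>, as dominated convergence
  requires.\<close>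

lemma norm_atom_kernel_le:
  fixes u :: complex and \<alpha> s C :: real
  assumes "0 < Im u" "norm (u - of_real \<alpha>) \<le> C * Im u"
  shows "norm ((u - of_real \<alpha>) / (u - of_real s)) \<le> C"
proof -
  have Im_le: "Im u \<le> norm (u - of_real s)"
    using abs_Im_le_cmod[of "u - of_real s"] by simp
  have "0 \<le> C * Im u"
    using assms(2) norm_ge_zero order_trans by blast
  then have "0 \<le> C"
    using assms(1) by (simp add: zero_le_mult_iff)
  then have "C * Im u \<le> C * norm (u - of_real s)"
    using Im_le by (rule mult_left_mono[rotated])
  then have "norm (u - of_real \<alpha>) \<le> C * norm (u - of_real s)" "0 < norm (u - of_real s)"
    using assms Im_le by linarith+
  then show ?thesis
    by (simp add: norm_divide pos_divide_le_eq del: zero_less_norm_iff)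
qed

text \<open>The rescaled kernels tend pointwise to the indicator of the joint atom and are dominated
  by \<open>C * D\<close>, so their integrals converge to its mass.\<close>

lemma (in prob_space) tendsto_bcauchy_atom:
  assumes [measurable]: "a \<in> borel_measurable M" "b \<in> borel_measurable M"
    and u: "u \<longlonglongrightarrow> of_real \<alpha>" "\<And>n. 0 < Im (u n)" "\<And>n. norm (u n - of_real \<alpha>) \<le> C * Im (u n)"
    and v: "v \<longlonglongrightarrow> of_real \<beta>" "\<And>n. 0 < Im (v n)" "\<And>n. norm (v n - of_real \<beta>) \<le> D * Im (v n)"
  shows "(\<lambda>n. (u n - of_real \<alpha>) * (v n - of_real \<beta>) * bcauchy M a b (u n) (v n))
           \<longlonglongrightarrow> of_real (prob {x \<in> space M. a x = \<alpha> \<and> b x = \<beta>})"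
proof -
  let ?k = "\<lambda>n x. ((u n - of_real \<alpha>) / (u n - of_real (a x))) * ((v n - of_real \<beta>) / (v n - of_real (b x)))"
  have "(u n - of_real \<alpha>) * (v n - of_real \<beta>) * bcauchy M a b (u n) (v n) = (\<integral>x. ?k n x \<partial>M)" for n
    unfolding bcauchy_def integral_mult_right_zero[symmetric]
    by (rule Bochner_Integration.integral_cong) auto
  moreover have "(\<lambda>n. \<integral>x. ?k n x \<partial>M)
      \<longlonglongrightarrow> (\<integral>x. of_real (indicator {x \<in> space M. a x = \<alpha> \<and> b x = \<beta>} x) \<partial>M)"
  proof (rule integral_dominated_convergence)
    show "AE x in M. (\<lambda>n. ?k n x) \<longlonglongrightarrow> of_real (indicator {x \<in> space M. a x = \<alpha> \<and> b x = \<beta>} x)"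
    proof (rule AE_I2)
      fix x assume "x \<in> space M"
      moreover have "u n \<noteq> of_real r" "v n \<noteq> of_real r" for n r
        using u(2)[of n] v(2)[of n] by auto
      ultimately show "(\<lambda>n. ?k n x) \<longlonglongrightarrow> of_real (indicator {x \<in> space M. a x = \<alpha> \<and> b x = \<beta>} x)"
        using tendsto_mult[OF tendsto_atom_kernel[OF u(1,2), of "a x"] tendsto_atom_kernel[OF v(1,2), of "b x"]]
        by (auto simp: indicator_def split: if_splits)
    qed
    show "AE x in M. norm (?k n x) \<le> C * D" for n
      using norm_atom_kernel_le[OF u(2,3)] norm_atom_kernel_le[OF v(2,3)]
      by (intro AE_I2) (unfold norm_mult, intro mult_mono, auto intro: order_trans[OF norm_ge_zero])
  qed simp_all
  moreover have "(\<integral>x. of_real (indicator {x \<in> space M. a x = \<alpha> \<and> b x = \<beta>} x) \<partial>M)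
      = complex_of_real (prob {x \<in> space M. a x = \<alpha> \<and> b x = \<beta>})"
    by (subst integral_complex_of_real) (auto intro!: arg_cong[where f = prob])
  ultimately show ?thesis
    by simp
qed

text \<open>This is the two-variable limit with second variable constantly \<open>0\<close> and
  \<open>v n = \<i> / Suc n\<close>: the rescaling factor \<open>v n\<close> cancels the second
  kernel \<open>1 / v n\<close>.\<close>

lemma (in prob_space) tendsto_wcauchy_atom:
  assumes [measurable]: "a \<in> borel_measurable M"
    and u: "u \<longlonglongrightarrow> of_real \<alpha>" "\<And>n. 0 < Im (u n)" "\<And>n. norm (u n - of_real \<alpha>) \<le> C * Im (u n)"
  shows "(\<lambda>n. (u n - of_real \<alpha>) * wcauchy M (\<lambda>_. 1) a (u n))
           \<longlonglongrightarrow> of_real (prob {x \<in> space M. a x = \<alpha>})"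
proof -
  define v where "v n = \<i> * of_real (1 / real (Suc n))" for n
  have v0: "v n \<noteq> 0" for n
    by (simp add: v_def del: of_nat_Suc)
  have lim: "v \<longlonglongrightarrow> of_real 0"
    unfolding v_def using tendsto_mult_right[OF tendsto_of_real[OF LIMSEQ_inverse_real_of_nat], of \<i>]
    by (simp add: field_simps)
  have "bcauchy M a (\<lambda>_. 0) (u n) (v n) = wcauchy M (\<lambda>_. 1) a (u n) / v n" for n
    unfolding bcauchy_def wcauchy_def integral_divide_zero[symmetric] by simp
  then have *: "(u n - of_real \<alpha>) * (v n - of_real 0) * bcauchy M a (\<lambda>_. 0) (u n) (v n)
      = (u n - of_real \<alpha>) * wcauchy M (\<lambda>_. 1) a (u n)" for n
    using v0 by simp
  have "(\<lambda>n. (u n - of_real \<alpha>) * (v n - of_real 0) * bcauchy M a (\<lambda>_. 0) (u n) (v n))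
           \<longlonglongrightarrow> of_real (prob {x \<in> space M. a x = \<alpha> \<and> 0 = (0::real)})"
    by (rule tendsto_bcauchy_atom[OF _ _ u lim, where D = 1]) (auto simp: v_def norm_mult norm_divide simp del: of_nat_Suc)
  then show ?thesis
    unfolding * by simp
qed

section \<open>Unweighted Cauchy transforms: decay, sign of the imaginary part, inverses\<close>

context bounded_rv
begin

lemma cauchy_at_infinity: "((\<lambda>z. z * wcauchy M (\<lambda>_. 1) a z) \<longlongrightarrow> 1) at_infinity"
  using wcauchy_at_infinity[of "\<lambda>_. 1" 1] by (simp add: prob_space)

lemma cauchy_holomorphic_upper: "wcauchy M (\<lambda>_. 1) a holomorphic_on {z. 0 < Im z}"
  by (rule wcauchy_holomorphic_upper[of _ 1]) auto

text \<open>The target is the punctured filter \<open>at 0\<close> because the inverses have a pole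
  at \<open>0\<close>. The transform does not vanish near infinity since \<open>z\<close> times it
  tends to \<open>1\<close>. Statements valid near \<open>0\<close> can thus be pulled back to
  infinity.\<close>

lemma filterlim_cauchy_at_infinity: "filterlim (wcauchy M (\<lambda>_. 1) a) (at 0) at_infinity"
proof -
  have "((\<lambda>z. (z * wcauchy M (\<lambda>_. 1) a z) * inverse z) \<longlongrightarrow> 1 * 0) at_infinity"
    by (intro tendsto_mult cauchy_at_infinity tendsto_inverse_0)
  moreover have nz: "\<forall>\<^sub>F z in at_infinity. z \<noteq> (0::complex)"
    unfolding eventually_at_infinity by (rule exI[of _ 1]) auto
  ultimately have "(wcauchy M (\<lambda>_. 1) a \<longlongrightarrow> 0) at_infinity"
    by (auto elim!: Lim_transform_eventually eventually_mono)
  moreover have "\<forall>\<^sub>F z in at_infinity. z * wcauchy M (\<lambda>_. 1) a z \<noteq> 0"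
    using tendsto_imp_eventually_ne[OF cauchy_at_infinity, of 0] by simp
  ultimately show ?thesis
    unfolding filterlim_at by (auto elim: eventually_mono)
qed

lemma inverse_near_infinity_cauchy: "\<exists>K. is_inverse_near_infinity (wcauchy M (\<lambda>_. 1) a) K"
proof -
  obtain R where R: "0 < R" "AE x in M. \<bar>a x\<bar> \<le> R"
    using bounded_AE by blast
  have "wcauchy M (\<lambda>_. 1) a holomorphic_on {z. R < norm z}"
    by (rule wcauchy_holomorphic_outside[where B = 1]) (use R in auto)
  then show ?thesis
    by (rule inverse_near_infinity_exists[OF R(1) _ cauchy_at_infinity])
qed

text \<open>The kernel has imaginary part \<open>- Im z / norm (z - a x)^2\<close>, which is
  negative for every \<open>x\<close>. The strict sign yields both nonvanishing of the transform and
  the self-map property of the subordination function.\<close>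

lemma Im_cauchy_neg:
  assumes z: "0 < Im z"
  shows "Im (wcauchy M (\<lambda>_. 1) a z) < 0"
proof -
  have "norm (1 / (z - of_real (a x))) \<le> 1 / Im z" for x
    unfolding norm_divide using z abs_Im_le_cmod[of "z - of_real (a x)"]
    by (intro frac_le) auto
  then have i: "integrable M (\<lambda>x. 1 / (z - of_real (a x)))"
    by (intro integrable_const_bound[where B = "1 / Im z"]) auto
  have "Im (1 / (z - of_real (a x))) < 0" for x
  proof -
    have "0 < (Re z - a x)\<^sup>2 + (Im z)\<^sup>2"
      using z by (intro add_nonneg_pos) auto
    then show ?thesis
      using z by (simp add: Im_divide)
  qed
  then have "(\<integral>x. Im (1 / (z - of_real (a x))) \<partial>M) < 0"
    using i by (intro expectation_less integrable_Im AE_I2)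
  then show ?thesis
    unfolding wcauchy_def using i by simp
qed

lemma inverse_asymptotics:
  assumes K: "is_inverse_near_infinity (wcauchy M (\<lambda>_. 1) a) K"
  shows "((\<lambda>z. z * K z) \<longlongrightarrow> 1) (at 0)"
proof -
  have "((\<lambda>z. K z * wcauchy M (\<lambda>_. 1) a (K z)) \<longlongrightarrow> 1) (at 0)"
    using K cauchy_at_infinity unfolding is_inverse_near_infinity_def
    by (auto intro: filterlim_compose)
  moreover have "\<forall>\<^sub>F z in at 0. K z * wcauchy M (\<lambda>_. 1) a (K z) = z * K z"
    using K unfolding is_inverse_near_infinity_def by (auto elim: eventually_mono)
  ultimately show ?thesis
    by (rule Lim_transform_eventually)
qed

end

section \<open>Subordination for one variable\<close>

locale subordination = base: bounded_rv M a + dilated: bounded_rv M' a'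
  for M :: "'a measure" and a and M' :: "'b measure" and a' +
  fixes t :: real and K K' :: "complex \<Rightarrow> complex"
  assumes t_gt_1: "1 < t"
    and K: "is_inverse_near_infinity (wcauchy M (\<lambda>_. 1) a) K"
    and K': "is_inverse_near_infinity (wcauchy M' (\<lambda>_. 1) a') K'"
    and dilation: "\<forall>\<^sub>F z in at 0. K' z - 1 / z = of_real t * (K z - 1 / z)"
begin

abbreviation "G \<equiv> wcauchy M (\<lambda>_. 1) a"
abbreviation "G' \<equiv> wcauchy M' (\<lambda>_. 1) a'"

text \<open>Solving \<open>dilation\<close> at the point \<open>G' z\<close> for
  \<open>K (G' z)\<close> gives this formula. The formula makes sense on the whole upper half-plane,
  whereas \<open>K\<close> is controlled only near \<open>0\<close>.\<close>

definition \<omega> :: "complex \<Rightarrow> complex" where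
  "\<omega> z = (z + of_real (t - 1) / G' z) / of_real t"

lemma omega_holomorphic: "\<omega> holomorphic_on {z. 0 < Im z}"
proof -
  have "G' z \<noteq> 0" if "0 < Im z" for z
    using dilated.Im_cauchy_neg[OF that] by auto
  then show ?thesis
    unfolding \<omega>_def using t_gt_1
    by (intro holomorphic_intros dilated.cauchy_holomorphic_upper) auto
qed

text \<open>\<open>Im (1 / G' z)\<close> is positive and \<open>t > 1\<close>, so the second summand
  only raises the imaginary part. The quantitative bound, beyond mere positivity, later shows that
  \<open>\<omega>\<close> approaches the real axis nontangentially.\<close>

lemma Im_omega_ge:
  assumes "0 < Im z"
  shows "Im z / t \<le> Im (\<omega> z)"
proof -
  have "0 \<le> Im (of_real (t - 1) / G' z)"
    using dilated.Im_cauchy_neg[OF assms] t_gt_1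
    by (simp add: Im_divide mult_nonneg_nonpos divide_nonpos_nonneg del: of_real_diff)
  then show ?thesis
    unfolding \<omega>_def using t_gt_1 by (simp add: divide_right_mono del: of_real_diff)
qed

lemma Im_omega_pos: "0 < Im z \<Longrightarrow> 0 < Im (\<omega> z)"
  using Im_omega_ge[of z] t_gt_1 divide_pos_pos[of "Im z" t] by linarith

lemma omega_near_infinity: "\<forall>\<^sub>F z in at_infinity. \<omega> z = K (G' z)"
proof -
  have "\<forall>\<^sub>F z in at_infinity. K' (G' z) - 1 / G' z = of_real t * (K (G' z) - 1 / G' z)"
    using dilation dilated.filterlim_cauchy_at_infinity by (rule eventually_compose_filterlim)
  moreover have "\<forall>\<^sub>F z in at_infinity. K' (G' z) = z"
    using K' by (simp add: is_inverse_near_infinity_def)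
  ultimately show ?thesis
  proof eventually_elim
    case (elim z)
    have "of_real t \<noteq> (0::complex)"
      using t_gt_1 by simp
    moreover have "of_real t * K (G' z) = z + of_real (t - 1) / G' z"
      using elim by (simp add: algebra_simps diff_divide_distrib)
    ultimately show ?case
      unfolding \<omega>_def by (metis nonzero_mult_div_cancel_left)
  qed
qed

lemma filterlim_omega: "filterlim \<omega> at_infinity at_infinity"
proof -
  have "filterlim (\<lambda>z. K (G' z)) at_infinity at_infinity"
    using K dilated.filterlim_cauchy_at_infinity
    unfolding is_inverse_near_infinity_def by (auto intro: filterlim_compose)
  then show ?thesis
    using omega_near_infinity by (simp add: filterlim_cong[OF refl refl omega_near_infinity])
qed

text \<open>Near infinity this is \<open>G (K (G' z)) = G' z\<close>. Both sides are holomorphic on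
  the upper half-plane because \<open>\<omega>\<close> maps it into itself.\<close>

lemma cauchy_omega:
  assumes "0 < Im z"
  shows "G (\<omega> z) = G' z"
proof (rule upper_half_plane_identity[of "\<lambda>z. G (\<omega> z)" G'])
  have "(G \<circ> \<omega>) holomorphic_on {z. 0 < Im z}"
    by (intro holomorphic_on_compose_gen[OF omega_holomorphic base.cauchy_holomorphic_upper])
      (use Im_omega_pos in auto)
  then show "(\<lambda>z. G (\<omega> z)) holomorphic_on {z. 0 < Im z}"
    by (simp add: o_def)
  have "\<forall>\<^sub>F z in at 0. G (K z) = z"
    using K by (simp add: is_inverse_near_infinity_def)
  then have "\<forall>\<^sub>F z in at_infinity. G (K (G' z)) = G' z"
    using dilated.filterlim_cauchy_at_infinity by (rule eventually_compose_filterlim)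
  then show "\<forall>\<^sub>F z in at_infinity. 0 < Im z \<longrightarrow> G (\<omega> z) = G' z"
    using omega_near_infinity by eventually_elim simp
qed (use assms dilated.cauchy_holomorphic_upper in auto)

end

text \<open>The height is positive from \<open>n = 0\<close> on and equals the distance to
  \<open>\<xi>\<close>, so the approach is nontangential with constant \<open>1\<close>. A sequence
  suits dominated convergence.\<close>

definition vertical :: "real \<Rightarrow> nat \<Rightarrow> complex" where
  "vertical \<xi> n = Complex \<xi> (1 / Suc n)"

lemma Im_vertical: "0 < Im (vertical \<xi> n)"
  by (simp add: vertical_def)

lemma norm_vertical_diff: "norm (vertical \<xi> n - of_real \<xi>) = Im (vertical \<xi> n)"
  by (simp add: vertical_def cmod_def del: of_nat_Suc)

lemma vertical_ne: "vertical \<xi> n \<noteq> of_real \<xi>"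
  using Im_vertical[of \<xi> n] by auto

lemma tendsto_vertical: "vertical \<xi> \<longlonglongrightarrow> of_real \<xi>"
  unfolding vertical_def complex_of_real_def
  by (intro tendsto_Complex tendsto_const) (use LIMSEQ_inverse_real_of_nat in \<open>simp add: field_simps\<close>)

section \<open>Boundary behaviour of the subordination function at an atom\<close>

context subordination
begin

context
  fixes \<xi> p :: real
  assumes p_def: "p = measure M' {x \<in> space M'. a' x = \<xi>}" and p: "0 < p"
begin

lemma tendsto_dilated_cauchy_atom:
  "(\<lambda>n. (vertical \<xi> n - of_real \<xi>) * G' (vertical \<xi> n)) \<longlonglongrightarrow> of_real p"
  unfolding p_def
  by (rule dilated.tendsto_wcauchy_atom[OF _ tendsto_vertical Im_vertical, where C = 1])
    (simp_all add: norm_vertical_diff)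

text \<open>The quotient equals \<open>1/t + ((t - 1)/t) / ((z - \<xi>) * G' z)\<close>, and the
  inner product tends to the atom \<open>p\<close>, which is nonzero.\<close>

lemma tendsto_omega_slope:
  "(\<lambda>n. (\<omega> (vertical \<xi> n) - of_real (\<xi> / t)) / (vertical \<xi> n - of_real \<xi>))
     \<longlonglongrightarrow> of_real ((p + t - 1) / (t * p))"
proof -
  have "(\<lambda>n. 1 / of_real t + of_real (t - 1) / of_real t / ((vertical \<xi> n - of_real \<xi>) * G' (vertical \<xi> n)))
     \<longlonglongrightarrow> 1 / of_real t + of_real (t - 1) / of_real t / of_real p"
    using p by (intro tendsto_intros tendsto_dilated_cauchy_atom) auto
  moreover have "1 / of_real t + of_real (t - 1) / of_real t / of_real p = complex_of_real ((p + t - 1) / (t * p))"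
    using p t_gt_1 by (simp add: field_simps)
  moreover have "1 / of_real t + of_real (t - 1) / of_real t / ((z - of_real \<xi>) * G' z)
      = (\<omega> z - of_real (\<xi> / t)) / (z - of_real \<xi>)"
    if "0 < Im z" for z
  proof -
    have "G' z \<noteq> 0"
      using dilated.Im_cauchy_neg[OF that] by auto
    moreover have "z - of_real \<xi> \<noteq> 0"
      using that by auto
    ultimately show ?thesis
      using t_gt_1 unfolding \<omega>_def by (simp add: divide_simps del: of_real_diff) (simp add: algebra_simps)
  qed
  ultimately show ?thesis
    using Im_vertical by simp
qed

lemma tendsto_omega_vertical: "(\<lambda>n. \<omega> (vertical \<xi> n)) \<longlonglongrightarrow> of_real (\<xi> / t)"
proof -
  have "(\<lambda>n. (\<omega> (vertical \<xi> n) - of_real (\<xi> / t)) / (vertical \<xi> n - of_real \<xi>) * (vertical \<xi> n - of_real \<xi>)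
      + of_real (\<xi> / t)) \<longlonglongrightarrow> of_real ((p + t - 1) / (t * p)) * (of_real \<xi> - of_real \<xi>) + of_real (\<xi> / t)"
    by (intro tendsto_intros tendsto_omega_slope tendsto_vertical)
  then show ?thesis
    using vertical_ne by simp
qed

text \<open>If \<open>B\<close> bounds the convergent slopes, then \<open>C = B * t\<close> works:
  the distance to \<open>\<xi> / t\<close> is at most \<open>B * Im z\<close>, and
  \<open>Im z \<le> t * Im (\<omega> z)\<close>.\<close>

lemma omega_vertical_nontangential:
  "\<exists>C. \<forall>n. norm (\<omega> (vertical \<xi> n) - of_real (\<xi> / t)) \<le> C * Im (\<omega> (vertical \<xi> n))"
proof -
  let ?r = "\<lambda>n. (\<omega> (vertical \<xi> n) - of_real (\<xi> / t)) / (vertical \<xi> n - of_real \<xi>)"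
  obtain B where B: "0 < B" "\<And>n. norm (?r n) \<le> B"
    using convergent_imp_Bseq[OF convergentI[OF tendsto_omega_slope]] unfolding Bseq_def by blast
  have "norm (\<omega> (vertical \<xi> n) - of_real (\<xi> / t)) \<le> B * t * Im (\<omega> (vertical \<xi> n))" for n
  proof -
    have "norm (\<omega> (vertical \<xi> n) - of_real (\<xi> / t)) = norm (?r n) * Im (vertical \<xi> n)"
      unfolding norm_vertical_diff[symmetric] norm_mult[symmetric] using vertical_ne by simp
    also have "\<dots> \<le> B * Im (vertical \<xi> n)"
      using B(2) Im_vertical[of \<xi> n] by (intro mult_right_mono) auto
    also have "Im (vertical \<xi> n) \<le> t * Im (\<omega> (vertical \<xi> n))"
      using Im_omega_ge[OF Im_vertical[of \<xi> n]] t_gt_1 by (simp add: field_simps)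
    finally show ?thesis
      using B(1) by (simp add: mult.assoc)
  qed
  then show ?thesis by blast
qed

text \<open>The base atom is the limit of \<open>(\<omega> z - \<xi> / t) * G (\<omega> z)\<close>.
  By \<open>G (\<omega> z) = G' z\<close> this is the slope times \<open>(z - \<xi>) * G' z\<close>,
  with limit \<open>(p + t - 1) / (t * p) * p\<close>.\<close>

lemma base_atom: "t * measure M {x \<in> space M. a x = \<xi> / t} = p + t - 1"
proof -
  let ?r = "\<lambda>n. (\<omega> (vertical \<xi> n) - of_real (\<xi> / t)) / (vertical \<xi> n - of_real \<xi>)"
  obtain C where C: "\<And>n. norm (\<omega> (vertical \<xi> n) - of_real (\<xi> / t)) \<le> C * Im (\<omega> (vertical \<xi> n))"
    using omega_vertical_nontangential by blast
  have lim: "(\<lambda>n. (\<omega> (vertical \<xi> n) - of_real (\<xi> / t)) * G (\<omega> (vertical \<xi> n)))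
      \<longlonglongrightarrow> of_real (measure M {x \<in> space M. a x = \<xi> / t})"
    by (rule base.tendsto_wcauchy_atom[OF _ tendsto_omega_vertical Im_omega_pos[OF Im_vertical] C]) simp
  have eq: "(\<omega> (vertical \<xi> n) - of_real (\<xi> / t)) * G (\<omega> (vertical \<xi> n))
      = ?r n * ((vertical \<xi> n - of_real \<xi>) * G' (vertical \<xi> n))" for n
    unfolding cauchy_omega[OF Im_vertical] using vertical_ne by simp
  have "(\<lambda>n. ?r n * ((vertical \<xi> n - of_real \<xi>) * G' (vertical \<xi> n)))
      \<longlonglongrightarrow> of_real ((p + t - 1) / (t * p)) * of_real p"
    by (intro tendsto_mult tendsto_omega_slope tendsto_dilated_cauchy_atom)
  then have "complex_of_real (measure M {x \<in> space M. a x = \<xi> / t}) = of_real ((p + t - 1) / (t * p)) * of_real p"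
    by (rule LIMSEQ_unique[OF lim[unfolded eq]])
  then have "measure M {x \<in> space M. a x = \<xi> / t} = (p + t - 1) / (t * p) * p"
    unfolding of_real_mult[symmetric] of_real_eq_iff .
  also have "\<dots> = (p + t - 1) / t"
    using p by simp
  finally show ?thesis
    using t_gt_1 by simp
qed

end

end

section \<open>Subordination for two variables\<close>

text \<open>The partial bi-free R-transform off the axes, after replacing \<open>z R(z)\<close> by
  \<open>z * K z - 1\<close> and likewise in \<open>w\<close>; the inverses are parameters.\<close>

definition bifree_R_rv ::
    "'a measure \<Rightarrow> ('a \<Rightarrow> real) \<Rightarrow> ('a \<Rightarrow> real) \<Rightarrow> (complex \<Rightarrow> complex) \<Rightarrow> (complex \<Rightarrow> complex)
      \<Rightarrow> complex \<Rightarrow> complex \<Rightarrow> complex" where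
  "bifree_R_rv M a b K L z w = z * K z + w * L w - 1 - z * w / bcauchy M a b (K z) (L w)"

lemma bifree_R_rv_commute: "bifree_R_rv M a b K L z w = bifree_R_rv M b a L K w z"
  unfolding bifree_R_rv_def by (simp add: bcauchy_commute[of M a] mult.commute)

lemma kernel_bounded_AE:
  fixes a :: "'a \<Rightarrow> real" and z :: complex
  assumes "AE x in M. \<bar>a x\<bar> \<le> R" "R < norm z"
  shows "AE x in M. norm (1 / (z - of_real (a x))) \<le> 1 / (norm z - R)"
  using assms(1)
proof eventually_elim
  case (elim x)
  then have "norm z - R \<le> norm (z - of_real (a x))"
    by (rule norm_minus_of_real_ge)
  then show ?case
    unfolding norm_divide using assms(2) by (intro frac_le) auto
qed

lemma norm_kernel_upper_le:
  assumes "0 < Im z"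
  shows "norm (1 / (z - of_real s)) \<le> 1 / Im z"
  unfolding norm_divide using assms abs_Im_le_cmod[of "z - of_real s"] by (intro frac_le) auto

text \<open>The point is that \<open>u G\<^sub>\<eta>(v, u) \<rightarrow> G\<^sub>\<mu>(v)\<close> as \<open>u \<rightarrow> \<infinity>\<close>, applied to \<open>v = K z\<close> and \<open>u = L w\<close>.\<close>

lemma bifree_R_rv_axis:
  assumes "bounded_rv M a" "bounded_rv M b"
    and K: "is_inverse_near_infinity (wcauchy M (\<lambda>_. 1) a) K"
    and L: "is_inverse_near_infinity (wcauchy M (\<lambda>_. 1) b) L"
  shows "\<forall>\<^sub>F z in at 0. ((\<lambda>w. bifree_R_rv M a b K L z w) \<longlongrightarrow> z * K z - 1) (at 0)"
proof -
  interpret a: bounded_rv M a by fact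
  interpret b: bounded_rv M b by fact
  obtain R where R: "0 < R" "AE x in M. \<bar>a x\<bar> \<le> R"
    using a.bounded_AE by blast
  have K_inf: "filterlim K at_infinity (at 0)" and L_inf: "filterlim L at_infinity (at 0)"
    using K L by (simp_all add: is_inverse_near_infinity_def)
  have "\<forall>\<^sub>F z in at 0. R + 1 \<le> norm (K z)"
    using K_inf R(1) unfolding filterlim_at_infinity[OF order_refl] by simp
  moreover have "\<forall>\<^sub>F z in at 0. wcauchy M (\<lambda>_. 1) a (K z) = z"
    using K by (simp add: is_inverse_near_infinity_def)
  moreover have "\<forall>\<^sub>F z in at 0. z \<noteq> (0::complex)"
    by (simp add: eventually_at_filter)
  ultimately show ?thesis
  proof eventually_elim
    case (elim z)
    define B where "B u = bcauchy M a b (K z) u" for u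
    have B: "((\<lambda>u. u * B u) \<longlongrightarrow> (\<integral>x. 1 / (K z - of_real (a x)) \<partial>M)) at_infinity"
      unfolding B_def bcauchy_eq_wcauchy_snd
      by (rule b.wcauchy_at_infinity[OF _ kernel_bounded_AE[OF R(2)]]) (use elim in auto)
    have "(\<integral>x. 1 / (K z - of_real (a x)) \<partial>M) = z"
      using elim(2) by (simp add: wcauchy_def)
    with filterlim_compose[OF B L_inf] have "((\<lambda>w. L w * B (L w)) \<longlongrightarrow> z) (at 0)"
      by simp
    \<comment> \<open>Expanding the fraction by \<open>L w\<close> makes numerator and denominator
      converge, since \<open>w * L w\<close> tends to \<open>1\<close> and
      \<open>L w * B (L w)\<close> to \<open>z\<close>.\<close>
    then have "((\<lambda>w. z * (w * L w) / (L w * B (L w))) \<longlongrightarrow> z * 1 / z) (at 0)"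
      by (intro tendsto_intros b.inverse_asymptotics[OF L] elim(3))
    moreover have "\<forall>\<^sub>F w in at 0. z * (w * L w) / (L w * B (L w)) = z * w / B (L w)"
      using filterlim_at_infinity_imp_eventually_ne[OF L_inf, of 0] by eventually_elim simp
    ultimately have "((\<lambda>w. z * w / B (L w)) \<longlongrightarrow> z * 1 / z) (at 0)"
      by (rule Lim_transform_eventually)
    then have "((\<lambda>w. z * K z + w * L w - 1 - z * w / B (L w)) \<longlongrightarrow> z * K z + 1 - 1 - z * 1 / z) (at 0)"
      by (intro tendsto_diff tendsto_add tendsto_const b.inverse_asymptotics[OF L])
    then show ?case
      unfolding bifree_R_rv_def B_def using elim(3) by simp
  qed
qed

text \<open>For fixed small \<open>z \<noteq> 0\<close> let \<open>w\<close> tend to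
  \<open>0\<close> in \<open>rel\<close>: the two sides tend to \<open>z * K' z - 1\<close> and
  \<open>t * (z * K z - 1)\<close>, and division by \<open>z\<close> gives the one-variable
  relation.\<close>

lemma dilation_of_bifree_R_rv:
  assumes bdd: "bounded_rv M a" "bounded_rv M b" "bounded_rv M' a'" "bounded_rv M' b'"
    and inv: "is_inverse_near_infinity (wcauchy M (\<lambda>_. 1) a) K"
      "is_inverse_near_infinity (wcauchy M (\<lambda>_. 1) b) L"
      "is_inverse_near_infinity (wcauchy M' (\<lambda>_. 1) a') K'"
      "is_inverse_near_infinity (wcauchy M' (\<lambda>_. 1) b') L'"
    and "0 < d"
    and rel: "\<And>z w. 0 < norm z \<Longrightarrow> norm z < d \<Longrightarrow> 0 < norm w \<Longrightarrow> norm w < d \<Longrightarrow>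
      bifree_R_rv M' a' b' K' L' z w = of_real t * bifree_R_rv M a b K L z w"
  shows "\<forall>\<^sub>F z in at 0. K' z - 1 / z = of_real t * (K z - 1 / z)"
proof -
  have near: "\<forall>\<^sub>F z in at 0. 0 < norm z \<and> norm z < d" for z :: complex
    unfolding eventually_at using \<open>0 < d\<close> by (auto simp: dist_norm)
  show ?thesis
    using near bifree_R_rv_axis[OF bdd(1,2) inv(1,2)] bifree_R_rv_axis[OF bdd(3,4) inv(3,4)]
  proof eventually_elim
    case (elim z)
    have "((\<lambda>w. of_real t * bifree_R_rv M a b K L z w) \<longlongrightarrow> of_real t * (z * K z - 1)) (at 0)"
      by (intro tendsto_intros elim)
    moreover have "\<forall>\<^sub>F w in at 0. of_real t * bifree_R_rv M a b K L z w = bifree_R_rv M' a' b' K' L' z w"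
      using near by eventually_elim (use rel elim in auto)
    ultimately have "((\<lambda>w. bifree_R_rv M' a' b' K' L' z w) \<longlongrightarrow> of_real t * (z * K z - 1)) (at 0)"
      by (rule Lim_transform_eventually)
    then have "z * K' z - 1 = of_real t * (z * K z - 1)"
      using elim(3) by (intro tendsto_unique[OF trivial_limit_at]) auto
    then show ?case
      using elim(1) by (simp add: field_simps)
  qed
qed

locale bifree_dilation =
  x: subordination M a M' a' t K K' + y: subordination M b M' b' t L L'
  for M :: "'a measure" and a b and M' :: "'b measure" and a' b' t K K' L L' +
  fixes d :: real
  assumes d: "0 < d"
    and bifree_dilation: "\<And>z w. 0 < norm z \<Longrightarrow> norm z < d \<Longrightarrow> 0 < norm w \<Longrightarrow> norm w < d \<Longrightarrow>
      bifree_R_rv M' a' b' K' L' z w = of_real t * bifree_R_rv M a b K L z w"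
begin

text \<open>Subtracting both one-variable relations from the two-variable one leaves only the
  quotient terms. The quantifiers are nested because \<open>z\<close> and \<open>w\<close> are later
  replaced by Cauchy transforms one after the other.\<close>

lemma bcauchy_quotient_dilation:
  "\<forall>\<^sub>F z in at 0. \<forall>\<^sub>F w in at 0.
     1 - z * w / bcauchy M' a' b' (K' z) (L' w)
       = of_real t * (1 - z * w / bcauchy M a b (K z) (L w))"
proof -
  have near: "\<forall>\<^sub>F z in at 0. 0 < norm z \<and> norm z < d" for z :: complex
    unfolding eventually_at using d by (auto simp: dist_norm)
  show ?thesis
    using near x.dilation
  proof eventually_elim
    case (elim z)
    show ?case
      using near y.dilation
    proof eventually_elim
      fix w
      assume w: "0 < norm w \<and> norm w < d" "L' w - 1 / w = of_real t * (L w - 1 / w)"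
      have "z * K' z - 1 = of_real t * (z * K z - 1)" "w * L' w - 1 = of_real t * (w * L w - 1)"
        using elim w by (simp_all add: field_simps)
      moreover have "bifree_R_rv M' a' b' K' L' z w = of_real t * bifree_R_rv M a b K L z w"
        using elim(1) w(1) by (intro bifree_dilation) auto
      moreover have "1 - z * w / bcauchy M' a' b' (K' z) (L' w)
          = bifree_R_rv M' a' b' K' L' z w - (z * K' z - 1) - (w * L' w - 1)"
        unfolding bifree_R_rv_def by simp
      moreover have "of_real t * (1 - z * w / bcauchy M a b (K z) (L w))
          = of_real t * bifree_R_rv M a b K L z w - of_real t * (z * K z - 1) - of_real t * (w * L w - 1)"
        unfolding bifree_R_rv_def right_diff_distrib[symmetric] by simp
      ultimately show "1 - z * w / bcauchy M' a' b' (K' z) (L' w)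
          = of_real t * (1 - z * w / bcauchy M a b (K z) (L w))"
        by simp
    qed
  qed
qed

section \<open>The two-variable subordination identity on the upper half-planes\<close>

lemma bcauchy_holomorphic_upper:
  assumes "bounded_rv N c" "bounded_rv N e"
  shows "0 < Im w \<Longrightarrow> (\<lambda>z. bcauchy N c e z w) holomorphic_on {z. 0 < Im z}"
    and "0 < Im z \<Longrightarrow> (\<lambda>w. bcauchy N c e z w) holomorphic_on {w. 0 < Im w}"
proof -
  interpret c: bounded_rv N c by fact
  interpret e: bounded_rv N e by fact
  show "0 < Im w \<Longrightarrow> (\<lambda>z. bcauchy N c e z w) holomorphic_on {z. 0 < Im z}"
    unfolding bcauchy_eq_wcauchy_fst
    using c.wcauchy_holomorphic_upper[of "\<lambda>x. 1 / (w - of_real (e x))" "1 / Im w"]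
    by (simp add: norm_kernel_upper_le[unfolded norm_divide norm_one] norm_divide)
  show "0 < Im z \<Longrightarrow> (\<lambda>w. bcauchy N c e z w) holomorphic_on {w. 0 < Im w}"
    unfolding bcauchy_eq_wcauchy_snd
    using e.wcauchy_holomorphic_upper[of "\<lambda>x. 1 / (z - of_real (c x))" "1 / Im z"]
    by (simp add: norm_kernel_upper_le[unfolded norm_divide norm_one] norm_divide)
qed

text \<open>Multiplied by \<open>w\<close>, the transform tends to the Cauchy transform of
  \<open>c\<close> at \<open>z\<close>, whose imaginary part is negative.\<close>

lemma bcauchy_eventually_nonzero:
  assumes "bounded_rv N c" "bounded_rv N e" "0 < Im z"
  shows "\<forall>\<^sub>F w in at_infinity. bcauchy N c e z w \<noteq> 0"
proof -
  interpret c: bounded_rv N c by fact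
  interpret e: bounded_rv N e by fact
  have "((\<lambda>w. w * bcauchy N c e z w) \<longlongrightarrow> (\<integral>x. 1 / (z - of_real (c x)) \<partial>N)) at_infinity"
    unfolding bcauchy_eq_wcauchy_snd
    by (rule e.wcauchy_at_infinity[where B = "1 / Im z"]) (use norm_kernel_upper_le[OF assms(3)] in auto)
  moreover have "(\<integral>x. 1 / (z - of_real (c x)) \<partial>N) \<noteq> 0"
    using c.Im_cauchy_neg[OF assms(3)] by (auto simp: wcauchy_def)
  ultimately have "\<forall>\<^sub>F w in at_infinity. w * bcauchy N c e z w \<noteq> 0"
    by (rule tendsto_imp_eventually_ne)
  then show ?thesis
    by eventually_elim auto
qed

text \<open>With \<open>A = G'(z) G'(w)\<close>, this is \<open>1 - A/g = t (1 - A/h)\<close>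
  cleared of the denominators \<open>g\<close> and \<open>h\<close>, whose zeros inside the
  half-planes are not controlled. In this form both sides are holomorphic in each variable
  separately.\<close>

lemma subordination_identity:
  assumes "0 < Im z" "0 < Im w"
  shows "bcauchy M a b (x.\<omega> z) (y.\<omega> w) * (x.G' z * y.G' w)
    = bcauchy M' a' b' z w
        * (of_real t * (x.G' z * y.G' w) - of_real (t - 1) * bcauchy M a b (x.\<omega> z) (y.\<omega> w))"
proof -
  note base = x.base.bounded_rv_axioms y.base.bounded_rv_axioms
  note dilated = x.dilated.bounded_rv_axioms y.dilated.bounded_rv_axioms
  define lhs where "lhs z w = bcauchy M a b (x.\<omega> z) (y.\<omega> w) * (x.G' z * y.G' w)" for z w
  define rhs where "rhs z w = bcauchy M' a' b' z w
        * (of_real t * (x.G' z * y.G' w) - of_real (t - 1) * bcauchy M a b (x.\<omega> z) (y.\<omega> w))" for z w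
  have hol_z: "(\<lambda>z. lhs z w) holomorphic_on {z. 0 < Im z}" "(\<lambda>z. rhs z w) holomorphic_on {z. 0 < Im z}"
    if "0 < Im w" for w
  proof -
    have "((\<lambda>z. bcauchy M a b z (y.\<omega> w)) \<circ> x.\<omega>) holomorphic_on {z. 0 < Im z}"
      by (intro holomorphic_on_compose_gen[OF x.omega_holomorphic bcauchy_holomorphic_upper(1)[OF base]])
        (use that x.Im_omega_pos y.Im_omega_pos in auto)
    then have "(\<lambda>z. bcauchy M a b (x.\<omega> z) (y.\<omega> w)) holomorphic_on {z. 0 < Im z}"
      by (simp add: o_def)
    note hol = this x.dilated.cauchy_holomorphic_upper bcauchy_holomorphic_upper(1)[OF dilated that]
    show "(\<lambda>z. lhs z w) holomorphic_on {z. 0 < Im z}"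
      unfolding lhs_def by (intro holomorphic_intros hol)
    show "(\<lambda>z. rhs z w) holomorphic_on {z. 0 < Im z}"
      unfolding rhs_def by (intro holomorphic_intros hol)
  qed
  have hol_w: "(\<lambda>w. lhs z w) holomorphic_on {w. 0 < Im w}" "(\<lambda>w. rhs z w) holomorphic_on {w. 0 < Im w}"
    if "0 < Im z" for z
  proof -
    have "((\<lambda>w. bcauchy M a b (x.\<omega> z) w) \<circ> y.\<omega>) holomorphic_on {w. 0 < Im w}"
      by (intro holomorphic_on_compose_gen[OF y.omega_holomorphic bcauchy_holomorphic_upper(2)[OF base]])
        (use that x.Im_omega_pos y.Im_omega_pos in auto)
    then have "(\<lambda>w. bcauchy M a b (x.\<omega> z) (y.\<omega> w)) holomorphic_on {w. 0 < Im w}"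
      by (simp add: o_def)
    note hol = this y.dilated.cauchy_holomorphic_upper bcauchy_holomorphic_upper(2)[OF dilated that]
    show "(\<lambda>w. lhs z w) holomorphic_on {w. 0 < Im w}"
      unfolding lhs_def by (intro holomorphic_intros hol)
    show "(\<lambda>w. rhs z w) holomorphic_on {w. 0 < Im w}"
      unfolding rhs_def by (intro holomorphic_intros hol)
  qed
  have x_inv: "\<forall>\<^sub>F z in at_infinity. K' (x.G' z) = z" and y_inv: "\<forall>\<^sub>F w in at_infinity. L' (y.G' w) = w"
    using x.K' y.K' by (simp_all add: is_inverse_near_infinity_def)
  have "\<forall>\<^sub>F z in at_infinity. \<forall>\<^sub>F w in at 0.
     1 - x.G' z * w / bcauchy M' a' b' (K' (x.G' z)) (L' w)
       = of_real t * (1 - x.G' z * w / bcauchy M a b (K (x.G' z)) (L w))"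
    by (rule eventually_compose_filterlim[OF bcauchy_quotient_dilation x.dilated.filterlim_cauchy_at_infinity])
  then have "\<forall>\<^sub>F z in at_infinity. 0 < Im z \<longrightarrow> (\<forall>w. 0 < Im w \<longrightarrow> lhs z w = rhs z w)"
    using x_inv x.omega_near_infinity
  proof eventually_elim
    case (elim z)
    show ?case
    proof (intro impI allI)
      fix w assume "0 < Im z" "0 < Im w"
      show "lhs z w = rhs z w"
      proof (rule upper_half_plane_identity[OF hol_w(1,2)])
        have "\<forall>\<^sub>F w in at_infinity. 1 - x.G' z * y.G' w / bcauchy M' a' b' (K' (x.G' z)) (L' (y.G' w))
            = of_real t * (1 - x.G' z * y.G' w / bcauchy M a b (K (x.G' z)) (L (y.G' w)))"
          by (rule eventually_compose_filterlim[OF elim(1) y.dilated.filterlim_cauchy_at_infinity])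
        \<comment> \<open>Nonvanishing is known when the second argument is near infinity, and
          \<open>y.\<omega>\<close> tends to infinity at infinity.\<close>
        moreover have "\<forall>\<^sub>F w in at_infinity. bcauchy M a b (x.\<omega> z) (y.\<omega> w) \<noteq> 0"
          by (rule eventually_compose_filterlim[OF bcauchy_eventually_nonzero y.filterlim_omega])
            (use base x.Im_omega_pos \<open>0 < Im z\<close> in auto)
        moreover have "\<forall>\<^sub>F w in at_infinity. bcauchy M' a' b' z w \<noteq> 0"
          by (rule bcauchy_eventually_nonzero[OF dilated \<open>0 < Im z\<close>])
        ultimately show "\<forall>\<^sub>F w in at_infinity. 0 < Im w \<longrightarrow> lhs z w = rhs z w"
          using y_inv y.omega_near_infinity
        proof eventually_elim
          case (elim w')
          define g h where "g = bcauchy M' a' b' z w'" and "h = bcauchy M a b (x.\<omega> z) (y.\<omega> w')"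
          have "1 - x.G' z * y.G' w' / g = of_real t * (1 - x.G' z * y.G' w' / h)"
            using elim \<open>K' (x.G' z) = z\<close> \<open>x.\<omega> z = K (x.G' z)\<close> unfolding g_def h_def by simp
          then have "h * (x.G' z * y.G' w') = g * (of_real t * (x.G' z * y.G' w') - of_real (t - 1) * h)"
            using elim(2,3) unfolding g_def[symmetric] h_def[symmetric]
            by (simp add: field_simps)
          then show ?case
            unfolding lhs_def rhs_def g_def h_def by simp
        qed
      qed fact+
    qed
  qed
  then have "\<forall>\<^sub>F z in at_infinity. 0 < Im z \<longrightarrow> lhs z w = rhs z w"
    by eventually_elim (use assms in auto)
  from upper_half_plane_identity[OF hol_z[OF assms(2)] this assms(1)]
  show ?thesis
    unfolding lhs_def rhs_def .
qed

text \<open>The limit of the subordination identity along the two vertical sequences, each transform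
  being rescaled by the distances to its own pair of points.\<close>

lemma atom_identity:
  fixes \<xi> \<zeta> :: real
  defines "p \<equiv> measure M' {x \<in> space M'. a' x = \<xi>}"
    and "q \<equiv> measure M' {x \<in> space M'. b' x = \<zeta>}"
    and "m \<equiv> measure M' {x \<in> space M'. a' x = \<xi> \<and> b' x = \<zeta>}"
    and "n \<equiv> measure M {x \<in> space M. a x = \<xi> / t \<and> b x = \<zeta> / t}"
    and "P \<equiv> measure M {x \<in> space M. a x = \<xi> / t}"
    and "Q \<equiv> measure M {x \<in> space M. b x = \<zeta> / t}"
  assumes p: "0 < p" and q: "0 < q"
  shows "n * p * q = m * (t * P * Q - (t - 1) * n)"
proof -
  let ?z = "vertical \<xi>" and ?w = "vertical \<zeta>"
  define g where "g n = bcauchy M' a' b' (?z n) (?w n)" for n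
  define h where "h n = bcauchy M a b (x.\<omega> (?z n)) (y.\<omega> (?w n))" for n
  define A where "A n = (?z n - of_real \<xi>) * x.G' (?z n)" for n
  define B where "B n = (?w n - of_real \<zeta>) * y.G' (?w n)" for n
  define r where "r n = (x.\<omega> (?z n) - of_real (\<xi> / t)) / (?z n - of_real \<xi>)" for n
  define s where "s n = (y.\<omega> (?w n) - of_real (\<zeta> / t)) / (?w n - of_real \<zeta>)" for n
  define H where "H n = (x.\<omega> (?z n) - of_real (\<xi> / t)) * (y.\<omega> (?w n) - of_real (\<zeta> / t)) * h n" for n
  define E where "E n = (?z n - of_real \<xi>) * (?w n - of_real \<zeta>) * g n" for n
  have A: "A \<longlonglongrightarrow> of_real p"
    unfolding A_def using x.tendsto_dilated_cauchy_atom[OF p_def[THEN meta_eq_to_obj_eq] p] .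
  have B: "B \<longlonglongrightarrow> of_real q"
    unfolding B_def using y.tendsto_dilated_cauchy_atom[OF q_def[THEN meta_eq_to_obj_eq] q] .
  have r: "r \<longlonglongrightarrow> of_real ((p + t - 1) / (t * p))"
    unfolding r_def using x.tendsto_omega_slope[OF p_def[THEN meta_eq_to_obj_eq] p] .
  have s: "s \<longlonglongrightarrow> of_real ((q + t - 1) / (t * q))"
    unfolding s_def using y.tendsto_omega_slope[OF q_def[THEN meta_eq_to_obj_eq] q] .
  have E: "E \<longlonglongrightarrow> of_real m"
    unfolding E_def g_def m_def
    by (rule x.dilated.tendsto_bcauchy_atom[OF _ _ tendsto_vertical Im_vertical _ tendsto_vertical Im_vertical,
          where C = 1 and D = 1]) (simp_all add: norm_vertical_diff)
  have H: "H \<longlonglongrightarrow> of_real n"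
  proof -
    obtain C where C: "\<And>n. norm (x.\<omega> (?z n) - of_real (\<xi> / t)) \<le> C * Im (x.\<omega> (?z n))"
      using x.omega_vertical_nontangential[OF p_def[THEN meta_eq_to_obj_eq] p] by blast
    obtain D where D: "\<And>n. norm (y.\<omega> (?w n) - of_real (\<zeta> / t)) \<le> D * Im (y.\<omega> (?w n))"
      using y.omega_vertical_nontangential[OF q_def[THEN meta_eq_to_obj_eq] q] by blast
    show ?thesis
      unfolding H_def h_def n_def
      by (rule x.base.tendsto_bcauchy_atom[OF _ _
            x.tendsto_omega_vertical[OF p_def[THEN meta_eq_to_obj_eq] p] x.Im_omega_pos[OF Im_vertical] C
            y.tendsto_omega_vertical[OF q_def[THEN meta_eq_to_obj_eq] q] y.Im_omega_pos[OF Im_vertical] D]) simp_all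
  qed
  have id: "H k * A k * B k = E k * (of_real t * (A k * B k * r k * s k) - of_real (t - 1) * H k)" for k
  proof -
    define u v where "u = ?z k - of_real \<xi>" and "v = ?w k - of_real \<zeta>"
    have uv: "u \<noteq> 0" "v \<noteq> 0"
      using vertical_ne by (auto simp: u_def v_def)
    have hH: "H k = r k * s k * u * v * h k"
      using uv unfolding H_def r_def s_def u_def v_def by simp
    have AB: "A k = u * x.G' (?z k)" "B k = v * y.G' (?w k)" "E k = u * v * g k"
      by (simp_all add: A_def B_def E_def u_def v_def)
    have "h k * (x.G' (?z k) * y.G' (?w k))
        = g k * (of_real t * (x.G' (?z k) * y.G' (?w k)) - of_real (t - 1) * h k)"
      unfolding g_def h_def by (rule subordination_identity[OF Im_vertical Im_vertical])
    \<comment> \<open>The transform \<open>h\<close> needs the factor \<open>r * s * u * v\<close>,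
      the distances on the base side, and the two marginal transforms need another
      \<open>u * v\<close>. The same total serves the right-hand side, where \<open>g\<close> takes
      \<open>u * v\<close>.\<close>
    then have "r k * s k * u\<^sup>2 * v\<^sup>2 * (h k * (x.G' (?z k) * y.G' (?w k)))
        = r k * s k * u\<^sup>2 * v\<^sup>2 * (g k * (of_real t * (x.G' (?z k) * y.G' (?w k)) - of_real (t - 1) * h k))"
      by simp
    then show ?thesis
      unfolding hH AB by (simp add: power2_eq_square algebra_simps del: of_real_diff)
  qed
  have "(\<lambda>k. H k * A k * B k) \<longlonglongrightarrow> of_real n * of_real p * of_real q"
    by (intro tendsto_mult A B H)
  moreover have "(\<lambda>k. H k * A k * B k)
     \<longlonglongrightarrow> of_real m * (of_real t * (of_real p * of_real q * of_real ((p + t - 1) / (t * p)) * of_real ((q + t - 1) / (t * q)))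
          - of_real (t - 1) * of_real n)"
    unfolding id by (intro tendsto_mult tendsto_diff tendsto_const A B r s E H)
  ultimately have "complex_of_real n * of_real p * of_real q
     = of_real m * (of_real t * (of_real p * of_real q * of_real ((p + t - 1) / (t * p)) * of_real ((q + t - 1) / (t * q)))
          - of_real (t - 1) * of_real n)"
    by (rule LIMSEQ_unique)
  then have "n * p * q = m * (t * (p * q * ((p + t - 1) / (t * p)) * ((q + t - 1) / (t * q))) - (t - 1) * n)"
    unfolding of_real_mult[symmetric] of_real_diff[symmetric] of_real_eq_iff .
  \<comment> \<open>By \<open>base_atom\<close>, \<open>t * P = p + t - 1\<close> and
    \<open>t * Q = q + t - 1\<close>, so the limits of \<open>A\<close>, \<open>B\<close>,
    \<open>r\<close>, \<open>s\<close> multiply to \<open>P * Q\<close>.\<close>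
  moreover have "p * ((p + t - 1) / (t * p)) = P" "q * ((q + t - 1) / (t * q)) = Q"
    unfolding P_def Q_def x.base_atom[OF p_def[THEN meta_eq_to_obj_eq] p, symmetric]
      y.base_atom[OF q_def[THEN meta_eq_to_obj_eq] q, symmetric]
    using p q x.t_gt_1 by simp_all
  then have "p * q * ((p + t - 1) / (t * p)) * ((q + t - 1) / (t * q)) = P * Q"
    by (metis mult.assoc mult.commute)
  ultimately have "n * p * q = m * (t * (P * Q) - (t - 1) * n)"
    by (simp only:)
  then show ?thesis
    by (simp add: mult.assoc)
qed

end

section \<open>Atoms of the semigroup\<close>

lemma compactly_supported_bounded_rv:
  fixes M :: "'a::metric_space measure" and f :: "'a \<Rightarrow> real"
  assumes M: "compactly_supported_prob M" and f: "continuous_on UNIV f"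
  shows "bounded_rv M f"
proof -
  obtain S where S: "compact S" "AE x in M. x \<in> S"
    using M by (auto simp: compactly_supported_prob_def)
  have "bounded (f ` S)"
    using S(1) f by (intro compact_imp_bounded compact_continuous_image) (auto intro: continuous_on_subset)
  then obtain R where R: "0 < R" "\<And>x. x \<in> S \<Longrightarrow> \<bar>f x\<bar> \<le> R"
    unfolding bounded_pos by auto
  interpret prob_space M
    using M by (simp add: compactly_supported_prob_def)
  show ?thesis
  proof
    have "f \<in> borel_measurable borel"
      using f by (rule borel_measurable_continuous_onI)
    then show "f \<in> borel_measurable M"
      using M by (simp add: compactly_supported_prob_def cong: measurable_cong_sets)
    have "AE x in M. \<bar>f x\<bar> \<le> R"
      using S(2) by eventually_elim (rule R(2))
    then show "\<exists>R>0. AE x in M. \<bar>f x\<bar> \<le> R"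
      using R(1) by blast
  qed
qed

lemma (in bounded_rv) cauchy_transform_distr:
  "cauchy_transform (distr M borel a) = wcauchy M (\<lambda>_. 1) a"
  unfolding cauchy_transform_def wcauchy_def by (intro ext integral_distr) auto

text \<open>Existence of an inverse near infinity gives the \<open>SOME\<close> in
  \<open>K_transform\<close> its defining property.\<close>

lemma (in bounded_rv) is_inverse_K_transform:
  "is_inverse_near_infinity (wcauchy M (\<lambda>_. 1) a) (K_transform (distr M borel a))"
  unfolding K_transform_def cauchy_transform_distr
  by (rule someI_ex[OF inverse_near_infinity_cauchy])

lemma bifree_R_transform_eq_rv:
  assumes "z \<noteq> 0" "w \<noteq> 0"
  shows "bifree_R_transform \<eta> z w
    = bifree_R_rv \<eta> fst snd (K_transform (marginal1 \<eta>)) (K_transform (marginal2 \<eta>)) z w"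
proof -
  have "cauchy_transform2 \<eta> z w = bcauchy \<eta> fst snd z w" for z w
    unfolding cauchy_transform2_def bcauchy_def
    by (rule Bochner_Integration.integral_cong) auto
  then show ?thesis
    using assms unfolding bifree_R_transform_def bifree_R_formula_def bifree_R_rv_def R_transform_def
    by (simp add: right_diff_distrib)
qed

theorem corollary4p2:
  fixes \<eta> :: "(real \<times> real) measure"
    and \<mu> \<nu> :: "real measure"
    and \<eta>t :: "real \<Rightarrow> (real \<times> real) measure"
    and t \<xi> \<zeta> :: real
  assumes "compactly_supported_prob \<eta>"
    and "\<mu> = marginal1 \<eta>"
    and "\<nu> = marginal2 \<eta>"
    and "bifree_convolution_semigroup \<eta> \<eta>t"
    and "t > 1"
    and "measure (\<eta>t t) {(\<xi>, \<zeta>)} > 0"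
  shows "measure \<eta> {(\<xi> / t, \<zeta> / t)} > 0 \<and>
    measure (\<eta>t t) {(\<xi>, \<zeta>)} =
      (t * measure \<mu> {\<xi> / t} + 1 - t) * (t * measure \<nu> {\<zeta> / t} + 1 - t)
          * measure \<eta> {(\<xi> / t, \<zeta> / t)}
        / (t * measure \<mu> {\<xi> / t} * measure \<nu> {\<zeta> / t}
          + (1 - t) * measure \<eta> {(\<xi> / t, \<zeta> / t)})"
proof -
  define \<theta> where "\<theta> = \<eta>t t"
  let ?K = "\<lambda>M. K_transform (marginal1 M)" and ?L = "\<lambda>M. K_transform (marginal2 M)"
  have \<theta>: "compactly_supported_prob \<theta>"
    and ev: "\<forall>\<^sub>F (z, w) in nhds (0, 0). bifree_R_transform \<theta> z w = of_real t * bifree_R_transform \<eta> z w"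
    using assms(4,5) unfolding bifree_convolution_semigroup_def \<theta>_def by auto
  have bdd: "bounded_rv \<eta> fst" "bounded_rv \<eta> snd" "bounded_rv \<theta> fst" "bounded_rv \<theta> snd"
    using assms(1) \<theta> by (auto intro!: compactly_supported_bounded_rv continuous_intros)
  have inv: "is_inverse_near_infinity (wcauchy \<eta> (\<lambda>_. 1) fst) (?K \<eta>)"
    "is_inverse_near_infinity (wcauchy \<eta> (\<lambda>_. 1) snd) (?L \<eta>)"
    "is_inverse_near_infinity (wcauchy \<theta> (\<lambda>_. 1) fst) (?K \<theta>)"
    "is_inverse_near_infinity (wcauchy \<theta> (\<lambda>_. 1) snd) (?L \<theta>)"
    unfolding marginal1_def marginal2_def by (intro bounded_rv.is_inverse_K_transform bdd)+
  obtain e where e: "0 < e" "\<And>z w. dist (z, w) (0, 0) < e \<Longrightarrow>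
      bifree_R_transform \<theta> z w = of_real t * bifree_R_transform \<eta> z w"
    using ev unfolding eventually_nhds_metric by (auto split: prod.splits)
  \<comment> \<open>Radius \<open>e / 2\<close> in each coordinate suffices because the norm of a
    pair is at most the sum of the norms.\<close>
  have rel: "bifree_R_rv \<theta> fst snd (?K \<theta>) (?L \<theta>) z w = of_real t * bifree_R_rv \<eta> fst snd (?K \<eta>) (?L \<eta>) z w"
    if "0 < norm z" "norm z < e / 2" "0 < norm w" "norm w < e / 2" for z w
  proof -
    have "dist (z, w) (0, 0) < e"
      using norm_Pair_le[of z w] that by (simp add: dist_norm)
    from e(2)[OF this] show ?thesis
      using that by (simp add: bifree_R_transform_eq_rv)
  qed
  have dil: "\<forall>\<^sub>F z in at 0. ?K \<theta> z - 1 / z = of_real t * (?K \<eta> z - 1 / z)"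
    using e(1) by (intro dilation_of_bifree_R_rv[OF bdd inv _ rel, where d = "e / 2"]) auto
  \<comment> \<open>The second marginal is treated by exchanging the coordinates.\<close>
  have dil': "\<forall>\<^sub>F z in at 0. ?L \<theta> z - 1 / z = of_real t * (?L \<eta> z - 1 / z)"
    using e(1) rel
    by (intro dilation_of_bifree_R_rv[OF bdd(2,1,4,3) inv(2,1,4,3), where d = "e / 2"])
      (auto simp: bifree_R_rv_commute[where a = snd])
  interpret \<eta>: prob_space \<eta>
    using assms(1) by (simp add: compactly_supported_prob_def)
  interpret \<theta>: prob_space \<theta>
    using \<theta> by (simp add: compactly_supported_prob_def)
  interpret bifree_dilation \<eta> fst snd \<theta> fst snd t "?K \<eta>" "?K \<theta>" "?L \<eta>" "?L \<theta>" "e / 2"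
    unfolding bifree_dilation_def bifree_dilation_axioms_def subordination_def subordination_axioms_def
    using bdd inv dil dil' assms(5) e(1) rel by simp
  have sets: "sets \<eta> = sets borel" "sets \<theta> = sets borel"
    using assms(1) \<theta> by (simp_all add: compactly_supported_prob_def)
  then have sp: "space \<eta> = UNIV" "space \<theta> = UNIV"
    by (metis sets_eq_imp_space_eq space_borel)+
  define p q where "p = measure \<theta> {x \<in> space \<theta>. fst x = \<xi>}" and "q = measure \<theta> {x \<in> space \<theta>. snd x = \<zeta>}"
  define P Q where "P = measure \<mu> {\<xi> / t}" and "Q = measure \<nu> {\<zeta> / t}"
  define m n where "m = measure \<theta> {(\<xi>, \<zeta>)}" and "n = measure \<eta> {(\<xi> / t, \<zeta> / t)}"
  have m: "0 < m"
    using assms(6) by (simp add: m_def \<theta>_def)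
  note [measurable] = x.dilated.measurable_rv y.dilated.measurable_rv
  \<comment> \<open>The point lies on a vertical and on a horizontal line, so both marginals of
    \<open>\<theta>\<close> have atoms; the boundary limits rely on this.\<close>
  have "m \<le> p"
    unfolding m_def p_def
  proof (rule \<theta>.finite_measure_mono)
    show "{x \<in> space \<theta>. fst x = \<xi>} \<in> \<theta>.events"
      by measurable
  qed (use sp in auto)
  moreover have "m \<le> q"
    unfolding m_def q_def
  proof (rule \<theta>.finite_measure_mono)
    show "{x \<in> space \<theta>. snd x = \<zeta>} \<in> \<theta>.events"
      by measurable
  qed (use sp in auto)
  ultimately have p: "0 < p" and q: "0 < q"
    using m by auto
  have P_eq: "P = measure \<eta> {x \<in> space \<eta>. fst x = \<xi> / t}"
    unfolding P_def assms(2) marginal1_def using x.base.measurable_rv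
    by (subst measure_distr) (auto intro!: arg_cong[where f = "measure \<eta>"])
  have Q_eq: "Q = measure \<eta> {x \<in> space \<eta>. snd x = \<zeta> / t}"
    unfolding Q_def assms(3) marginal2_def using y.base.measurable_rv
    by (subst measure_distr) (auto intro!: arg_cong[where f = "measure \<eta>"])
  have m_eq: "m = measure \<theta> {x \<in> space \<theta>. fst x = \<xi> \<and> snd x = \<zeta>}"
    unfolding m_def sp by (auto intro!: arg_cong[where f = "measure \<theta>"])
  have n_eq: "n = measure \<eta> {x \<in> space \<eta>. fst x = \<xi> / t \<and> snd x = \<zeta> / t}"
    unfolding n_def sp by (auto intro!: arg_cong[where f = "measure \<eta>"])
  \<comment> \<open>This identifies the factors \<open>t * P + 1 - t\<close> and
    \<open>t * Q + 1 - t\<close> of the claim with the marginal atoms \<open>p\<close> and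
    \<open>q\<close> of \<open>\<theta>\<close>.\<close>
  have tP: "t * P = p + t - 1" and tQ: "t * Q = q + t - 1"
    using x.base_atom[OF p_def p] y.base_atom[OF q_def q] by (simp_all add: P_eq Q_eq)
  have main: "n * p * q = m * (t * P * Q - (t - 1) * n)"
    using atom_identity[of \<xi> \<zeta>] p q unfolding p_def q_def m_eq n_eq P_eq Q_eq by simp
  have "0 < t * P" "0 < t * Q"
    using tP tQ p q assms(5) by linarith+
  then have PQ: "0 < P" "0 < Q"
    using assms(5) by (simp_all add: zero_less_mult_iff)
  \<comment> \<open>For \<open>n = 0\<close> the equation \<open>main\<close> would read
    \<open>0 = m * (t * P * Q)\<close>, a product of positive numbers.\<close>
  have "n \<noteq> 0"
    using main m PQ assms(5) by auto
  then have n: "0 < n"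
    unfolding n_def by (simp add: less_le)
  then have "0 < m * (t * P * Q - (t - 1) * n)"
    using p q main[symmetric] by simp
  \<comment> \<open>The denominator is positive because \<open>m\<close> and its product with
    \<open>m\<close> are, so \<open>main\<close> can be solved for \<open>m\<close>.\<close>
  then have D: "0 < t * P * Q - (t - 1) * n"
    using m by (simp add: zero_less_mult_iff)
  then have "m = n * p * q / (t * P * Q - (t - 1) * n)"
    using main by (simp add: nonzero_eq_divide_eq)
  also have "\<dots> = (t * P + 1 - t) * (t * Q + 1 - t) * n / (t * P * Q + (1 - t) * n)"
    unfolding tP tQ by (simp add: algebra_simps)
  finally show ?thesis
    using n unfolding m_def n_def P_def Q_def \<theta>_def by simp
qed

end
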